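(* Let $n\geq 3$ be an integer, let $k\geq 2$ be an even integer, and let $G$ be a connected graph of order $n$. (1) If ($n \geq 7$ or $n=3$ or $n=5$) and $\rho(G)\geq \rho(K_1 \vee (K_{n-2}+K_1))$, then $G$ is $\mathrm{GFC}_k$ when $n$ is odd and $\mathrm{GBC}_k$ when $n$ is even, unless $G = K_1 \vee (K_{n-2}+K_1)$. (2) If $n\in\{4,6\}$ and $\rho(G)\geq \rho(K_{\frac{n}{2}} \vee \frac{n}{2}K_1)$, then $G$ is $\mathrm{GBC}_k$ unless $G = K_{\frac{n}{2}} \vee \frac{n}{2}K_1$.
   Context: All graphs are finite, simple and undirected. The order of $G$ is its number of vertices. $\rho(G)$ is the largest eigenvalue of the adjacency matrix of $G$. $K_m$ is the complete graph on $m$ vertices, $G_1+G_2$ is the (vertex-disjoint) union, $mK_1$ is the graph consisting of $m$ isolated vertices, and the join $G_1\vee G_2$ is obtained from vertex-disjoint $G_1,G_2$ by adding all edges between $V(G_1)$ and $V(G_2)$. Equality of graphs means isomorphism. Let $i(H)$ denote the number of isolated vertices of a graph $H$. For even $k$ define $$\mathrm{def}_k(G)=\max_{S\subseteq V(G)}\{k\cdot i(G-S)-k|S|\}.$$ A $k$-barrier of $G$ is a subset $S\subseteq V(G)$ attaining this maximum. A graph $G$ of odd order (resp. even order) is generalized factor-critical, written $\mathrm{GFC}_k$ (resp. generalized bicritical, written $\mathrm{GBC}_k$), if $\emptyset$ is its only $k$-barrier. *)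

theory Defs
  imports
    "Jordan_Normal_Form.Spectral_Radius"
    "Graph_Theory.Digraph_Isomorphism"
begin

text \<open>
  Finite simple undirected graphs are the \<^locale>\<open>pair_graph\<close>s of the AFP entry Graph Theory: an
  edge \<open>uv\<close> is represented by the two arcs \<open>(u, v)\<close> and \<open>(v, u)\<close>, and there are no loops.
\<close>

section \<open>Graph constructions\<close>

definition complete_graph :: "nat \<Rightarrow> nat pair_pre_digraph" where
  "complete_graph m = \<lparr> pverts = {..<m}, parcs = {(u, v). u < m \<and> v < m \<and> u \<noteq> v} \<rparr>"

definition edgeless_graph :: "nat \<Rightarrow> nat pair_pre_digraph" where
  "edgeless_graph m = \<lparr> pverts = {..<m}, parcs = {} \<rparr>"

text \<open>The sum type makes the vertex sets of the two operands disjoint.\<close>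

definition disjoint_union ::
  "'a pair_pre_digraph \<Rightarrow> 'b pair_pre_digraph \<Rightarrow> ('a + 'b) pair_pre_digraph" where
  "disjoint_union G H = \<lparr> pverts = pverts G <+> pverts H,
     parcs = map_prod Inl Inl ` parcs G \<union> map_prod Inr Inr ` parcs H \<rparr>"

definition graph_join ::
  "'a pair_pre_digraph \<Rightarrow> 'b pair_pre_digraph \<Rightarrow> ('a + 'b) pair_pre_digraph" where
  "graph_join G H = \<lparr> pverts = pverts (disjoint_union G H),
     parcs = parcs (disjoint_union G H)
       \<union> Inl ` pverts G \<times> Inr ` pverts H
       \<union> Inr ` pverts H \<times> Inl ` pverts G \<rparr>"

lemma pair_graph_complete_graph: "pair_graph (complete_graph m)"
proof
  show "finite (parcs (complete_graph m))"
    by (rule finite_subset[of _ "{..<m} \<times> {..<m}"]) (auto simp: complete_graph_def)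
qed (auto simp: complete_graph_def symmetric_def sym_def)

lemma pair_graph_edgeless_graph: "pair_graph (edgeless_graph m)"
  by unfold_locales (auto simp: edgeless_graph_def symmetric_def sym_def)

lemma pair_graph_disjoint_union:
  assumes "pair_graph G" "pair_graph H"
  shows "pair_graph (disjoint_union G H)"
proof -
  interpret G: pair_graph G by fact
  interpret H: pair_graph H by fact
  have "sym (parcs G)" "sym (parcs H)"
    using G.pair_sym_arcs H.pair_sym_arcs by (auto simp: symmetric_def)
  then show ?thesis
    by unfold_locales
      (auto simp: disjoint_union_def symmetric_def sym_def
        dest: G.wellformed' H.wellformed' G.pair_no_loops H.pair_no_loops)
qed

lemma pair_graph_graph_join:
  assumes "pair_graph G" "pair_graph H"
  shows "pair_graph (graph_join G H)"
proof -
  interpret G: pair_graph G by fact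
  interpret H: pair_graph H by fact
  interpret U: pair_graph "disjoint_union G H" by (rule pair_graph_disjoint_union) fact+
  have "sym (parcs (disjoint_union G H))"
    using U.pair_sym_arcs by (auto simp: symmetric_def)
  moreover have "pverts (disjoint_union G H) = pverts G <+> pverts H"
    by (simp add: disjoint_union_def)
  ultimately show ?thesis
    by unfold_locales
      (auto simp: graph_join_def symmetric_def sym_def dest: U.wellformed' U.pair_no_loops)
qed

text \<open>
  Isomorphism is expressed by \<^const>\<open>digraph_iso\<close>, which for graphs without parallel arcs amounts
  to the usual notion.
\<close>

lemma digraph_iso_with_proj_iff:
  assumes "pair_graph G" "pair_graph H"
  shows "digraph_iso (with_proj G) (with_proj H) \<longleftrightarrow>
    (\<exists>f. bij_betw f (pverts G) (pverts H) \<and>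
      (\<forall>u\<in>pverts G. \<forall>v\<in>pverts G. (u, v) \<in> parcs G \<longleftrightarrow> (f u, f v) \<in> parcs H))"
    (is "?L \<longleftrightarrow> ?R")
proof
  interpret G: pair_graph G by fact
  interpret H: pair_graph H by fact
  {
    assume ?L
    then obtain h where h: "pre_digraph.digraph_isomorphism (with_proj G) h"
      and H: "with_proj H = app_iso h (with_proj G)"
      by (auto simp: digraph_iso_def)
    let ?f = "iso_verts h"
    have verts: "pverts H = ?f ` pverts G" and arcs: "parcs H = iso_arcs h ` parcs G"
      and tail: "iso_tail h = fst" and head: "iso_head h = snd"
      using H by (simp_all add: with_proj_def app_iso_def)
    have inj: "inj_on ?f (pverts G)"
      using h by (simp add: pre_digraph.digraph_isomorphism_def)
    have arc: "iso_arcs h a = (?f (fst a), ?f (snd a))" if "a \<in> parcs G" for a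
      using h that by (simp add: pre_digraph.digraph_isomorphism_def tail head)
    have "(u, v) \<in> parcs G \<longleftrightarrow> (?f u, ?f v) \<in> parcs H"
      if "u \<in> pverts G" "v \<in> pverts G" for u v
    proof
      assume "(u, v) \<in> parcs G"
      then show "(?f u, ?f v) \<in> parcs H" using arc[of "(u, v)"] arcs by force
    next
      assume "(?f u, ?f v) \<in> parcs H"
      then obtain a where a: "a \<in> parcs G" "(?f u, ?f v) = iso_arcs h a" using arcs by blast
      then have "?f u = ?f (fst a)" "?f v = ?f (snd a)" using arc[OF a(1)] by simp_all
      moreover have "fst a \<in> pverts G" "snd a \<in> pverts G"
        using a(1) G.arc_fst_in_verts G.arc_snd_in_verts by auto
      ultimately have "a = (u, v)" using inj that by (metis inj_onD prod.collapse)
      with a show "(u, v) \<in> parcs G" by simp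
    qed
    then show ?R using inj verts by (auto simp: bij_betw_def)
  next
    assume ?R
    then obtain f where bij: "bij_betw f (pverts G) (pverts H)"
      and f: "\<And>u v. u \<in> pverts G \<Longrightarrow> v \<in> pverts G \<Longrightarrow> (u, v) \<in> parcs G \<longleftrightarrow> (f u, f v) \<in> parcs H"
      by blast
    let ?h = "\<lparr> iso_verts = f, iso_arcs = map_prod f f, iso_head = snd, iso_tail = fst \<rparr>"
    have inj: "inj_on f (pverts G)" and verts: "f ` pverts G = pverts H"
      using bij by (auto simp: bij_betw_def)
    have "parcs G \<subseteq> pverts G \<times> pverts G" by (auto dest: G.wellformed')
    then have inj': "inj_on (map_prod f f) (parcs G)"
      using map_prod_inj_on[OF inj inj] inj_on_subset by blast
    have "parcs H \<subseteq> map_prod f f ` parcs G"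
    proof (rule subrelI)
      fix x y assume xy: "(x, y) \<in> parcs H"
      then have "x \<in> f ` pverts G" "y \<in> f ` pverts G" using H.wellformed' verts by auto
      then obtain u v where uv: "u \<in> pverts G" "v \<in> pverts G" "x = f u" "y = f v" by blast
      then have "(u, v) \<in> parcs G" using f xy by simp
      then show "(x, y) \<in> map_prod f f ` parcs G" using uv by force
    qed
    moreover have "map_prod f f ` parcs G \<subseteq> parcs H"
      using f by (auto dest: G.wellformed')
    ultimately have arcs: "map_prod f f ` parcs G = parcs H" by blast
    have "pre_digraph.digraph_isomorphism (with_proj G) ?h"
      using inj inj' G.wf_digraph by (simp add: pre_digraph.digraph_isomorphism_def)
    moreover have "with_proj H = app_iso ?h (with_proj G)"
      by (simp add: app_iso_def with_proj_def verts arcs)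
    ultimately show ?L unfolding digraph_iso_def by blast
  }
qed


section \<open>The largest adjacency eigenvalue\<close>

definition adjacency_matrix :: "'a pair_pre_digraph \<Rightarrow> 'a list \<Rightarrow> real mat" where
  "adjacency_matrix G vs = mat (length vs) (length vs)
     (\<lambda>(i, j). if (vs ! i, vs ! j) \<in> parcs G then 1 else 0)"

text \<open>
  Matrix indices are natural numbers, so an enumeration of the vertices has to be chosen. The
  choice does not matter, see \<open>rho_eq\<close> below.
\<close>

definition rho :: "'a pair_pre_digraph \<Rightarrow> real" where
  "rho G = Max (spectrum (adjacency_matrix G (SOME vs. distinct vs \<and> set vs = pverts G)))"

lemma eigenvalue_adjacency_matrix_iff:
  assumes "distinct vs" "set vs = pverts G"
  shows "eigenvalue (adjacency_matrix G vs) x \<longleftrightarrow>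
    (\<exists>f. (\<exists>v\<in>pverts G. f v \<noteq> 0) \<and>
      (\<forall>v\<in>pverts G. (\<Sum>u\<in>pverts G. (if (v, u) \<in> parcs G then 1 else 0) * f u) = x * f v))"
    (is "_ \<longleftrightarrow> (\<exists>f. ?P f)")
proof
  let ?n = "length vs"
  have bij: "bij_betw (\<lambda>i. vs ! i) {..<?n} (pverts G)"
    using assms by (metis bij_betw_nth)
  have sum: "(\<Sum>u\<in>pverts G. g u) = (\<Sum>i<?n. g (vs ! i))" for g :: "'a \<Rightarrow> real"
    using sum.reindex_bij_betw[OF bij, of g] by simp
  have mem: "v \<in> pverts G \<longleftrightarrow> (\<exists>i<?n. v = vs ! i)" for v
    using assms(2) by (metis in_set_conv_nth)
  {
    assume "eigenvalue (adjacency_matrix G vs) x"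
    then obtain w where w: "w \<in> carrier_vec ?n" "w \<noteq> 0\<^sub>v ?n" "adjacency_matrix G vs *\<^sub>v w = x \<cdot>\<^sub>v w"
      unfolding eigenvalue_def eigenvector_def by (auto simp: adjacency_matrix_def)
    define f where "f v = w $ (THE i. i < ?n \<and> vs ! i = v)" for v
    have f_nth: "f (vs ! i) = w $ i" if "i < ?n" for i
    proof -
      have "(THE j. j < ?n \<and> vs ! j = vs ! i) = i"
        using that assms(1) by (auto simp: nth_eq_iff_index_eq)
      then show ?thesis by (simp add: f_def)
    qed
    have "\<exists>i<?n. w $ i \<noteq> 0"
    proof (rule ccontr)
      assume "\<not> (\<exists>i<?n. w $ i \<noteq> 0)"
      then have "w = 0\<^sub>v ?n" using w(1) by (intro eq_vecI) auto
      with w(2) show False ..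
    qed
    then have ex: "\<exists>i<?n. f (vs ! i) \<noteq> 0" using f_nth by auto
    have eq: "(\<Sum>j<?n. (if (vs ! i, vs ! j) \<in> parcs G then 1 else 0) * f (vs ! j)) = x * f (vs ! i)"
      if "i < ?n" for i
    proof -
      have "(\<Sum>j<?n. (if (vs ! i, vs ! j) \<in> parcs G then 1 else 0) * f (vs ! j))
          = (\<Sum>j<?n. (if (vs ! i, vs ! j) \<in> parcs G then 1 else 0) * w $ j)"
        by (rule sum.cong) (simp_all add: f_nth)
      also have "\<dots> = (adjacency_matrix G vs *\<^sub>v w) $ i"
        using that w(1) by (simp add: adjacency_matrix_def scalar_prod_def atLeast0LessThan)
      also have "\<dots> = x * w $ i" using that w by simp
      finally show ?thesis using that by (simp add: f_nth)
    qed
    obtain i where "i < ?n" "f (vs ! i) \<noteq> 0" using ex by (elim exE conjE)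
    then have "\<exists>v\<in>pverts G. f v \<noteq> 0" using mem[of "vs ! i"] by (intro bexI[of _ "vs ! i"]) auto
    moreover have "(\<Sum>u\<in>pverts G. (if (v, u) \<in> parcs G then 1 else 0) * f u) = x * f v"
      if v: "v \<in> pverts G" for v
    proof -
      obtain i where "i < ?n" "v = vs ! i"
        using v[unfolded mem] by (elim exE conjE)
      then show ?thesis using eq by (simp only: sum)
    qed
    ultimately have "?P f" by blast
    then show "\<exists>f. ?P f" by - (rule exI[where x = f])
  next
    assume "\<exists>f. ?P f"
    then obtain f where f: "?P f" ..
    let ?w = "vec ?n (\<lambda>i. f (vs ! i))"
    obtain v where v: "v \<in> pverts G" "f v \<noteq> 0" using f by (elim conjE bexE)
    obtain i where "i < ?n" "v = vs ! i"
      using v(1)[unfolded mem] by (elim exE conjE)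
    with v have i: "i < ?n" "f (vs ! i) \<noteq> 0" by simp_all
    have "?w \<noteq> 0\<^sub>v ?n"
    proof
      assume "?w = 0\<^sub>v ?n"
      then have "?w $ i = 0\<^sub>v ?n $ i" by simp
      with i show False by simp
    qed
    moreover have "adjacency_matrix G vs *\<^sub>v ?w = x \<cdot>\<^sub>v ?w"
    proof (rule eq_vecI)
      fix j assume "j < dim_vec (x \<cdot>\<^sub>v ?w)"
      then have j: "j < ?n" by simp
      then have "vs ! j \<in> pverts G" using assms(2) nth_mem by blast
      with f have "(\<Sum>u\<in>pverts G. (if (vs ! j, u) \<in> parcs G then 1 else 0) * f u) = x * f (vs ! j)"
        by blast
      then have "(\<Sum>k<?n. (if (vs ! j, vs ! k) \<in> parcs G then 1 else 0) * f (vs ! k)) = x * f (vs ! j)"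
        by (simp only: sum)
      then show "(adjacency_matrix G vs *\<^sub>v ?w) $ j = (x \<cdot>\<^sub>v ?w) $ j"
        using j by (simp add: adjacency_matrix_def scalar_prod_def atLeast0LessThan)
    qed (simp add: adjacency_matrix_def)
    ultimately show "eigenvalue (adjacency_matrix G vs) x"
      unfolding eigenvalue_def eigenvector_def
      by (intro exI[of _ ?w]) (simp add: adjacency_matrix_def)
  }
qed

lemma rho_eq:
  assumes "distinct vs" "set vs = pverts G"
  shows "rho G = Max (spectrum (adjacency_matrix G vs))"
proof -
  let ?ws = "SOME vs. distinct vs \<and> set vs = pverts G"
  have "distinct ?ws \<and> set ?ws = pverts G"
    by (rule someI[of _ vs]) (use assms in simp)
  then have "spectrum (adjacency_matrix G ?ws) = spectrum (adjacency_matrix G vs)"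
    using assms eigenvalue_adjacency_matrix_iff[of ?ws G] eigenvalue_adjacency_matrix_iff[of vs G]
    by (auto simp: spectrum_def)
  then show ?thesis by (simp add: rho_def)
qed


section \<open>Barriers\<close>

definition isolated_verts :: "('a, 'b) pre_digraph \<Rightarrow> 'a set" where
  "isolated_verts H = {v \<in> verts H. in_arcs H v = {} \<and> out_arcs H v = {}}"

definition delete_verts :: "'a pair_pre_digraph \<Rightarrow> 'a set \<Rightarrow> ('a, 'a \<times> 'a) pre_digraph" where
  "delete_verts G S = with_proj G \<restriction> (pverts G - S)"

definition barrier_value :: "nat \<Rightarrow> 'a pair_pre_digraph \<Rightarrow> 'a set \<Rightarrow> int" where
  "barrier_value k G S =
     int k * int (card (isolated_verts (delete_verts G S))) - int k * int (card S)"

text \<open>The following notions are only meant for even \<open>k\<close>.\<close>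

definition k_deficiency :: "nat \<Rightarrow> 'a pair_pre_digraph \<Rightarrow> int" where
  "k_deficiency k G = Max (barrier_value k G ` Pow (pverts G))"

definition k_barrier :: "nat \<Rightarrow> 'a pair_pre_digraph \<Rightarrow> 'a set \<Rightarrow> bool" where
  "k_barrier k G S \<longleftrightarrow> S \<subseteq> pverts G \<and> barrier_value k G S = k_deficiency k G"

definition GFC :: "nat \<Rightarrow> 'a pair_pre_digraph \<Rightarrow> bool" where
  "GFC k G \<longleftrightarrow> odd (card (pverts G)) \<and> {S. k_barrier k G S} = {{}}"

definition GBC :: "nat \<Rightarrow> 'a pair_pre_digraph \<Rightarrow> bool" where
  "GBC k G \<longleftrightarrow> even (card (pverts G)) \<and> {S. k_barrier k G S} = {{}}"

end

theory Submission
  imports Defs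
begin

text \<open>
  A nonempty barrier \<open>S\<close> has value at least that of \<open>\<emptyset>\<close>, hence \<open>G - S\<close> has at least \<open>s = |S|\<close> isolated
  vertices and \<open>G\<close> is a spanning subgraph of \<open>K\<^sub>s \<or> (K\<^bsub>n-2s\<^esub> + sK\<^sub>1)\<close>. Positive functions that are constant on
  the three parts bound \<open>\<rho>(G)\<close> from above as supersolutions. For the extremal value of \<open>s\<close> such a
  function is an eigenfunction of the large graph, and equality forces \<open>G\<close> to contain all of its
  edges. For the other values of \<open>s\<close> a suitable supersolution gives a rational bound below the
  spectral radius of the extremal graph; in part (1) this bound is \<open>n - 2\<close>.
\<close>

section \<open>Spectra of graphs\<close>

text \<open>A complex eigenpair always exists. The Hermitian form of a real symmetric matrix takes
  real values, so the eigenvalue is real, and then the real or the imaginary part of the eigenvector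
  is a real eigenvector.\<close>

lemma real_symmetric_spectrum_nonempty:
  fixes A :: "real mat"
  assumes A: "A \<in> carrier_mat n n" and n: "n > 0"
    and sym: "\<And>i j. i < n \<Longrightarrow> j < n \<Longrightarrow> A $$ (i, j) = A $$ (j, i)"
  shows "spectrum A \<noteq> {}"
proof -
  let ?B = "map_mat complex_of_real A"
  have B: "?B \<in> carrier_mat n n" using A by simp
  obtain z v where v: "v \<in> carrier_vec n" "v \<noteq> 0\<^sub>v n" "?B *\<^sub>v v = z \<cdot>\<^sub>v v"
    using spectrum_non_empty[OF B n] A unfolding spectrum_def eigenvalue_def eigenvector_def
    by auto
  have eq: "(\<Sum>j<n. of_real (A $$ (i, j)) * v $ j) = z * v $ i" if i: "i < n" for i
  proof -
    have "(\<Sum>j<n. of_real (A $$ (i, j)) * v $ j) = (?B *\<^sub>v v) $ i"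
      using i A v(1) by (simp add: scalar_prod_def atLeast0LessThan)
    then show ?thesis using i v by simp
  qed
  define N where "N = (\<Sum>i<n. (cmod (v $ i))\<^sup>2)"
  have nz: "\<exists>i<n. v $ i \<noteq> 0"
  proof (rule ccontr)
    assume "\<not> (\<exists>i<n. v $ i \<noteq> 0)"
    then have "v = 0\<^sub>v n" using v(1) by (intro eq_vecI) auto
    with v(2) show False ..
  qed
  then have "N \<noteq> 0" unfolding N_def by (subst sum_nonneg_eq_0_iff) auto
  \<comment> \<open>\<open>Q\<close> is the Hermitian form at \<open>v\<close>, evaluated in two
    ways: as \<open>z\<close> times the squared norm \<open>N\<close>, and as its own conjugate by
    symmetry of \<open>A\<close>.\<close>
  define Q where "Q = (\<Sum>i<n. \<Sum>j<n. of_real (A $$ (i, j)) * (cnj (v $ i) * v $ j))"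
  have "Q = (\<Sum>i<n. cnj (v $ i) * (\<Sum>j<n. of_real (A $$ (i, j)) * v $ j))"
    unfolding Q_def by (simp add: sum_distrib_left algebra_simps)
  also have "\<dots> = (\<Sum>i<n. cnj (v $ i) * (z * v $ i))"
    by (intro sum.cong refl) (simp add: eq)
  also have "\<dots> = (\<Sum>i<n. z * of_real ((cmod (v $ i))\<^sup>2))"
    by (intro sum.cong refl, simp only: complex_norm_square, simp add: ac_simps)
  also have "\<dots> = z * of_real N"
    unfolding N_def of_real_sum sum_distrib_left ..
  finally have Q: "Q = z * of_real N" .
  have "cnj Q = (\<Sum>i<n. \<Sum>j<n. of_real (A $$ (i, j)) * (cnj (v $ j) * v $ i))"
    unfolding Q_def by (simp add: algebra_simps)
  also have "\<dots> = (\<Sum>j<n. \<Sum>i<n. of_real (A $$ (i, j)) * (cnj (v $ j) * v $ i))"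
    by (rule sum.swap)
  also have "\<dots> = Q"
    unfolding Q_def by (intro sum.cong refl) (simp add: sym)
  finally have "cnj z * of_real N = z * of_real N" using Q by simp
  then have "cnj z = z" using \<open>N \<noteq> 0\<close> by simp
  then have Im: "Im z = 0" by (simp add: complex_eq_iff)
  \<comment> \<open>Either part of \<open>v\<close> satisfies the eigenvalue equation, since
    \<open>A\<close> and \<open>z\<close> are real. The choice only ensures a nonzero vector, as
    \<open>v\<close> might be purely imaginary.\<close>
  define part where "part = (if \<exists>i<n. Re (v $ i) \<noteq> 0 then Re else Im)"
  define w where "w = vec n (\<lambda>i. part (v $ i))"
  have "\<exists>i<n. part (v $ i) \<noteq> 0"
    using nz by (auto simp: part_def complex_eq_iff)
  then have "w \<noteq> 0\<^sub>v n" unfolding w_def by (metis index_vec index_zero_vec(1))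
  moreover have "A *\<^sub>v w = Re z \<cdot>\<^sub>v w"
  proof (rule eq_vecI)
    fix i assume "i < dim_vec (Re z \<cdot>\<^sub>v w)"
    then have i: "i < n" by (simp add: w_def)
    have "(\<Sum>j<n. A $$ (i, j) * part (v $ j)) = part (\<Sum>j<n. of_real (A $$ (i, j)) * v $ j)"
      by (simp add: part_def)
    also have "\<dots> = Re z * part (v $ i)"
      using Im by (simp add: eq[OF i] part_def)
    finally show "(A *\<^sub>v w) $ i = (Re z \<cdot>\<^sub>v w) $ i"
      using i A by (simp add: w_def scalar_prod_def atLeast0LessThan)
  qed (use A in \<open>simp add: w_def\<close>)
  moreover have "w \<in> carrier_vec n" by (simp add: w_def)
  ultimately have "eigenvector A w (Re z)" using A by (auto simp: eigenvector_def)
  then show ?thesis by (auto simp: spectrum_def eigenvalue_def)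
qed

text \<open>The right-hand side of \<open>eigenvalue_adjacency_matrix_iff\<close>, so that
  eigenfunctions live on the vertices and no enumeration has to be carried along.\<close>

definition graph_eigenvalue :: "'a pair_pre_digraph \<Rightarrow> real \<Rightarrow> bool" where
  "graph_eigenvalue G x \<longleftrightarrow> (\<exists>f. (\<exists>v\<in>pverts G. f v \<noteq> 0) \<and>
      (\<forall>v\<in>pverts G. (\<Sum>u\<in>pverts G. (if (v, u) \<in> parcs G then 1 else 0) * f u) = x * f v))"

text \<open>The \<open>Max\<close> in \<open>rho\<close> is meaningful because the spectrum is
  finite and, by symmetry of the adjacency matrix, nonempty.\<close>

lemma rho_graph_eigenvalue:
  assumes "pair_graph G" and ne: "pverts G \<noteq> {}"
  shows "graph_eigenvalue G (rho G)" and "graph_eigenvalue G x \<Longrightarrow> x \<le> rho G"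
proof -
  interpret G: pair_graph G by fact
  obtain vs where vs: "distinct vs" "set vs = pverts G"
    using finite_distinct_list[OF G.pair_finite_verts] by blast
  let ?A = "adjacency_matrix G vs"
  have A: "?A \<in> carrier_mat (length vs) (length vs)" by (simp add: adjacency_matrix_def)
  have iff: "graph_eigenvalue G x \<longleftrightarrow> x \<in> spectrum ?A" for x
    unfolding graph_eigenvalue_def spectrum_def mem_Collect_eq
    by (rule eigenvalue_adjacency_matrix_iff[OF vs, symmetric])
  have fin: "finite (spectrum ?A)" by (rule card_finite_spectrum(1)[OF A])
  have sym: "(u, v) \<in> parcs G \<longleftrightarrow> (v, u) \<in> parcs G" for u v
    using G.pair_sym_arcs by (auto simp: symmetric_def sym_def)
  have "spectrum ?A \<noteq> {}"
  proof (rule real_symmetric_spectrum_nonempty[OF A])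
    show "0 < length vs" using ne vs(2) by auto
  qed (auto simp: adjacency_matrix_def sym)
  with fin show "graph_eigenvalue G (rho G)"
    unfolding iff rho_eq[OF vs] by (rule Max_in)
  show "x \<le> rho G" if "graph_eigenvalue G x"
    using fin that unfolding iff rho_eq[OF vs] by (rule Max_ge)
qed

section \<open>Positive supersolutions on connected graphs\<close>

lemma connected_closed_eq_verts:
  assumes "pair_graph G" and conn: "Digraph_Component.connected (with_proj G)"
    and X: "X \<subseteq> pverts G" "X \<noteq> {}"
    and closed: "\<And>u v. u \<in> X \<Longrightarrow> (u, v) \<in> parcs G \<Longrightarrow> v \<in> X"
  shows "X = pverts G"
proof
  interpret G: pair_graph G by fact
  have sym: "(v, u) \<in> parcs G \<Longrightarrow> (u, v) \<in> parcs G" for u v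
    using G.pair_sym_arcs by (auto simp: symmetric_def sym_def)
  \<comment> \<open>Connectedness speaks of paths in the symmetric closure, so closure under
    reversed arcs is needed as well.\<close>
  have closed': "v \<in> X" if "u \<in> X" "(v, u) \<in> parcs G" for u v
    using that by (blast intro: closed sym)
  obtain x where x: "x \<in> X" using X by blast
  show "pverts G \<subseteq> X"
  proof
    fix v assume "v \<in> pverts G"
    then have "x \<rightarrow>\<^sup>*\<^bsub>with_proj (mk_symmetric G)\<^esub> v"
      using conn x X(1)
      by (auto simp: Digraph_Component.connected_def strongly_connected_def)
    then have "(x, v) \<in> (parcs (mk_symmetric G))\<^sup>*"
      using reachable_rtranclI by fastforce
    then show "v \<in> X"
      by (induction rule: rtrancl_induct)
        (auto simp: x mk_symmetric_def intro: closed closed')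
  qed
qed fact

text \<open>
  A positive supersolution \<open>y\<close> dominates the eigenfunction \<open>f\<close>: at the vertices where \<open>|f| / y\<close>
  is maximal the supersolution inequality is evaluated, and equality spreads along arcs.
\<close>

lemma rho_le_supersolution:
  fixes y :: "'a \<Rightarrow> real"
  assumes G: "pair_graph G" and conn: "Digraph_Component.connected (with_proj G)"
    and ne: "pverts G \<noteq> {}"
    and sub: "parcs G \<subseteq> R" and R: "R \<subseteq> pverts G \<times> pverts G"
    and pos: "\<And>v. v \<in> pverts G \<Longrightarrow> y v > 0"
    and super: "\<And>v. v \<in> pverts G \<Longrightarrow>
      (\<Sum>u\<in>pverts G. (if (v, u) \<in> R then 1 else 0) * y u) \<le> \<theta> * y v"
  shows "rho G \<le> \<theta>" and "rho G = \<theta> \<Longrightarrow> parcs G = R"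
proof -
  interpret G: pair_graph G by fact
  let ?V = "pverts G"
  define \<mu> where "\<mu> = rho G"
  obtain f where f: "\<exists>v\<in>?V. f v \<noteq> 0"
    and eig: "\<And>v. v \<in> ?V \<Longrightarrow>
      (\<Sum>u\<in>?V. (if (v, u) \<in> parcs G then 1 else 0) * f u) = \<mu> * f v"
    using rho_graph_eigenvalue(1)[OF G ne] unfolding graph_eigenvalue_def \<mu>_def by blast
  \<comment> \<open>\<open>t\<close> is the least factor with \<open>|f| \<le> t * y\<close>, and
    \<open>T\<close> is the set of vertices where the two functions touch.\<close>
  define t where "t = Max ((\<lambda>v. \<bar>f v\<bar> / y v) ` ?V)"
  define T where "T = {v \<in> ?V. \<bar>f v\<bar> = t * y v}"
  have t: "\<bar>f v\<bar> \<le> t * y v" if "v \<in> ?V" for v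
  proof -
    have "\<bar>f v\<bar> / y v \<le> t" unfolding t_def using that by (intro Max_ge) auto
    then show ?thesis using pos[OF that] by (simp add: divide_le_eq)
  qed
  obtain v0 where v0: "v0 \<in> ?V" "f v0 \<noteq> 0" using f by blast
  have "0 < \<bar>f v0\<bar>" using v0 by simp
  then have "0 < t * y v0" using t[OF v0(1)] by linarith
  then have t_pos: "t > 0" using pos[OF v0(1)] by (simp add: zero_less_mult_iff)
  have "t \<in> (\<lambda>v. \<bar>f v\<bar> / y v) ` ?V" unfolding t_def using ne by (intro Max_in) auto
  then obtain v1 where v1: "v1 \<in> ?V" "t = \<bar>f v1\<bar> / y v1" by blast
  then have T_ne: "v1 \<in> T" using pos[OF v1(1)] by (simp add: T_def)
  have dominated: "(if (v, u) \<in> parcs G then 1 else 0) * \<bar>f u\<bar>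
      \<le> t * ((if (v, u) \<in> R then 1 else 0) * y u)" if "u \<in> ?V" for u v
    using t[OF that] sub pos[OF that] t_pos by auto
  \<comment> \<open>The triangle inequality in the eigenvalue equation; at a vertex of
    \<open>T\<close> the value \<open>|f v|\<close> may be replaced by
    \<open>t * y v\<close>.\<close>
  have lower: "\<mu> * (t * y v) \<le> (\<Sum>u\<in>?V. (if (v, u) \<in> parcs G then 1 else 0) * \<bar>f u\<bar>)"
    if v: "v \<in> T" for v
  proof -
    have "\<mu> * (t * y v) = \<mu> * \<bar>f v\<bar>" using v by (simp add: T_def)
    also have "\<dots> \<le> \<bar>\<mu> * f v\<bar>" by (simp add: abs_mult mult_right_mono)
    also have "\<mu> * f v = (\<Sum>u\<in>?V. (if (v, u) \<in> parcs G then 1 else 0) * f u)"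
      using v eig by (simp add: T_def)
    also have "\<bar>\<dots>\<bar> \<le> (\<Sum>u\<in>?V. \<bar>(if (v, u) \<in> parcs G then 1 else 0) * f u\<bar>)"
      by (rule sum_abs)
    also have "\<dots> = (\<Sum>u\<in>?V. (if (v, u) \<in> parcs G then 1 else 0) * \<bar>f u\<bar>)"
      by (intro sum.cong) auto
    finally show ?thesis .
  qed
  have upper: "(\<Sum>u\<in>?V. t * ((if (v, u) \<in> R then 1 else 0) * y u)) \<le> \<theta> * (t * y v)"
    if v: "v \<in> T" for v
  proof -
    have "t * (\<Sum>u\<in>?V. (if (v, u) \<in> R then 1 else 0) * y u) \<le> t * (\<theta> * y v)"
      using super v t_pos by (intro mult_left_mono) (auto simp: T_def)
    then show ?thesis by (simp add: sum_distrib_left algebra_simps)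
  qed
  have "\<mu> * (t * y v1) \<le> \<theta> * (t * y v1)"
    using lower[OF T_ne] upper[OF T_ne]
      sum_mono[of ?V "\<lambda>u. (if (v1, u) \<in> parcs G then 1 else 0) * \<bar>f u\<bar>"
        "\<lambda>u. t * ((if (v1, u) \<in> R then 1 else 0) * y u)", OF dominated]
    by linarith
  then show "rho G \<le> \<theta>" using pos[OF v1(1)] t_pos by (simp add: \<mu>_def)
  assume "rho G = \<theta>"
  then have eq: "\<mu> = \<theta>" by (simp add: \<mu>_def)
  \<comment> \<open>With \<open>\<mu> = \<theta>\<close> the bounds \<open>lower\<close> and
    \<open>upper\<close> force the two sums to agree, and termwise domination then gives equality of
    every term.\<close>
  have tight: "(if (v, u) \<in> parcs G then 1 else 0) * \<bar>f u\<bar>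
      = t * ((if (v, u) \<in> R then 1 else 0) * y u)" if v: "v \<in> T" and u: "u \<in> ?V" for u v
  proof -
    have "(\<Sum>u\<in>?V. t * ((if (v, u) \<in> R then 1 else 0) * y u)
        - (if (v, u) \<in> parcs G then 1 else 0) * \<bar>f u\<bar>) \<le> 0"
      using lower[OF v] upper[OF v] unfolding sum_subtractf eq by linarith
    then have "(\<Sum>u\<in>?V. t * ((if (v, u) \<in> R then 1 else 0) * y u)
        - (if (v, u) \<in> parcs G then 1 else 0) * \<bar>f u\<bar>) = 0"
      using dominated by (intro antisym sum_nonneg) (simp_all only: diff_ge_0_iff_ge)
    then have "\<forall>u\<in>?V. t * ((if (v, u) \<in> R then 1 else 0) * y u)
        - (if (v, u) \<in> parcs G then 1 else 0) * \<bar>f u\<bar> = 0"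
      using dominated by (subst (asm) sum_nonneg_eq_0_iff) (simp_all only: G.pair_finite_verts diff_ge_0_iff_ge)
    then show ?thesis using u by (metis eq_iff_diff_eq_0)
  qed
  \<comment> \<open>For an arc of \<open>R\<close> the right-hand term of \<open>tight\<close> is
    positive, so the arc must lie in \<open>G\<close> and its head must touch again.\<close>
  have spread: "(v, u) \<in> parcs G \<and> u \<in> T" if v: "v \<in> T" and vu: "(v, u) \<in> R" for u v
  proof -
    have u: "u \<in> ?V" using vu R by blast
    have "(if (v, u) \<in> parcs G then 1 else 0) * \<bar>f u\<bar> = t * y u"
      using tight[OF v u] vu by simp
    moreover have "t * y u > 0" using t_pos pos[OF u] by simp
    ultimately show ?thesis using u by (auto simp: T_def split: if_splits)
  qed
  have "T = ?V"
  proof (rule connected_closed_eq_verts[OF G conn])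
    show "T \<subseteq> ?V" by (auto simp: T_def)
    show "T \<noteq> {}" using T_ne by blast
    show "v \<in> T" if "u \<in> T" "(u, v) \<in> parcs G" for u v
      using spread[OF that(1)] that(2) sub by blast
  qed
  then show "parcs G = R" using spread sub R by fast
qed

section \<open>Graphs with a barrier\<close>

text \<open>
  \<open>max_arcs\<close> makes the graph \<open>K\<^sub>s \<or> (K\<^bsub>n-2s\<^esub> + sK\<^sub>1)\<close> with \<open>s = |S| = |I|\<close>,
  the edge-maximal one in which the vertices of \<open>I\<close> become isolated after the deletion of \<open>S\<close>.
\<close>

locale vertex_split =
  fixes V S I :: "'a set"
  assumes finite_V: "finite V" and S_subset: "S \<subseteq> V" and I_subset: "I \<subseteq> V"
    and disjoint: "S \<inter> I = {}" and card_I: "card I = card S"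
begin

definition max_arcs :: "('a \<times> 'a) set" where
  "max_arcs = {(u, v). u \<in> V \<and> v \<in> V \<and> u \<noteq> v \<and> (u \<in> I \<longrightarrow> v \<in> S) \<and> (v \<in> I \<longrightarrow> u \<in> S)}"

definition weight :: "real \<Rightarrow> real \<Rightarrow> real \<Rightarrow> 'a \<Rightarrow> real" where
  "weight a b c v = (if v \<in> S then a else if v \<in> I then c else b)"

lemma card_rest: "card V = 2 * card S + card (V - S - I)"
proof -
  have "card V = card (S \<union> I) + card (V - (S \<union> I))"
    using finite_V S_subset I_subset by (metis Un_least card_Diff_subset card_mono finite_subset le_add_diff_inverse)
  moreover have "card (S \<union> I) = 2 * card S"
    using card_Un_disjoint[of S I] disjoint finite_V S_subset I_subset card_I
    by (metis finite_subset mult_2)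
  ultimately show ?thesis by (simp add: Diff_eq Int_assoc)
qed

text \<open>The three parts form an equitable partition: the right-hand side is the quotient matrix
  applied to \<open>(a, b, c)\<close>. The terms with \<open>- 1\<close> reflect the absence of
  loops in the cliques on \<open>S\<close> and on the rest.\<close>

lemma sum_weight:
  fixes a b c :: real
  assumes v: "v \<in> V" and s: "card S = s" and n: "card V = n"
  shows "(\<Sum>u\<in>V. (if (v, u) \<in> max_arcs then 1 else 0) * weight a b c u) =
    (if v \<in> S then (real s - 1) * a + (real n - 2 * real s) * b + real s * c
     else if v \<in> I then real s * a
     else real s * a + (real n - 2 * real s - 1) * b)"
proof -
  let ?y = "weight a b c"
  have S: "sum ?y S = real s * a" by (simp add: weight_def s)
  have I: "sum ?y I = real s * c"
  proof -
    have "sum ?y I = (\<Sum>u\<in>I. c)" using disjoint by (intro sum.cong) (auto simp: weight_def)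
    then show ?thesis by (simp add: card_I s)
  qed
  have C: "sum ?y (V - S - I) = (real n - 2 * real s) * b"
  proof -
    have "sum ?y (V - S - I) = (\<Sum>u\<in>V - S - I. b)" by (intro sum.cong) (auto simp: weight_def)
    then show ?thesis using card_rest s n by simp
  qed
  have VI: "sum ?y (V - I) = sum ?y (V - S - I) + sum ?y S"
  proof -
    have "V - I = (V - S - I) \<union> S" using S_subset disjoint by blast
    then show ?thesis using finite_V S_subset by (metis (no_types, lifting) Diff_Diff_Int Diff_disjoint
      Int_commute Int_Diff finite_Diff finite_subset inf_bot_left sum.union_disjoint)
  qed
  have VV: "sum ?y V = sum ?y (V - I) + sum ?y I"
    using finite_V I_subset by (rule sum.subset_diff[rotated])
  have "(\<Sum>u\<in>V. (if (v, u) \<in> max_arcs then 1 else 0) * ?y u)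
      = (\<Sum>u\<in>V. if (v, u) \<in> max_arcs then ?y u else 0)"
    by (intro sum.cong) auto
  also have "\<dots> = sum ?y {u \<in> V. (v, u) \<in> max_arcs}"
    using finite_V by (simp add: sum.inter_filter)
  also have "\<dots> = (if v \<in> S then (real s - 1) * a + (real n - 2 * real s) * b + real s * c
     else if v \<in> I then real s * a
     else real s * a + (real n - 2 * real s - 1) * b)"
  proof -
    consider "v \<in> S" | "v \<in> I" "v \<notin> S" | "v \<notin> S" "v \<notin> I" by blast
    then show ?thesis
    proof cases
      case 1
      then have "{u \<in> V. (v, u) \<in> max_arcs} = V - {v}"
        using disjoint v by (auto simp: max_arcs_def)
      then have "sum ?y {u \<in> V. (v, u) \<in> max_arcs} = sum ?y V - ?y v"
        using finite_V v by (simp add: sum_diff1)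
      moreover have "?y v = a" using 1 by (simp add: weight_def)
      ultimately show ?thesis using 1 VV VI S I C by (simp add: algebra_simps)
    next
      case 2
      then have "{u \<in> V. (v, u) \<in> max_arcs} = S"
        using S_subset disjoint v by (auto simp: max_arcs_def)
      then show ?thesis using 2 S by simp
    next
      case 3
      then have "{u \<in> V. (v, u) \<in> max_arcs} = (V - I) - {v}"
        using v by (auto simp: max_arcs_def)
      then have "sum ?y {u \<in> V. (v, u) \<in> max_arcs} = sum ?y (V - I) - ?y v"
        using finite_V v 3 by (simp add: sum_diff1)
      moreover have "?y v = b" using 3 by (simp add: weight_def)
      ultimately show ?thesis using 3 VI S C by (simp add: algebra_simps)
    qed
  qed
  finally show ?thesis .
qed

end

section \<open>Spectral bounds and rigidity for graphs split into three parts\<close>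

lemma rho_le_split:
  assumes "vertex_split (pverts G) S I"
    and G: "pair_graph G" and conn: "Digraph_Component.connected (with_proj G)"
    and ne: "pverts G \<noteq> {}"
    and sub: "parcs G \<subseteq> vertex_split.max_arcs (pverts G) S I"
    and s: "card S = s" and n: "card (pverts G) = n"
    and pos: "a > 0" "b > 0" "c > 0"
    and S: "(real s - 1) * a + (real n - 2 * real s) * b + real s * c \<le> \<theta> * a"
    and C: "real s * a + (real n - 2 * real s - 1) * b \<le> \<theta> * b"
    and I: "real s * a \<le> \<theta> * c"
  shows "rho G \<le> \<theta>" and "rho G = \<theta> \<Longrightarrow> parcs G = vertex_split.max_arcs (pverts G) S I"
proof -
  interpret vertex_split "pverts G" S I by fact
  have R: "max_arcs \<subseteq> pverts G \<times> pverts G" by (auto simp: max_arcs_def)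
  have w_pos: "weight a b c v > 0" for v using pos by (simp add: weight_def)
  have super: "(\<Sum>u\<in>pverts G. (if (v, u) \<in> max_arcs then 1 else 0) * weight a b c u)
      \<le> \<theta> * weight a b c v" if "v \<in> pverts G" for v
    unfolding sum_weight[OF that s n] using S C I by (simp add: weight_def)
  show "rho G \<le> \<theta>" "rho G = \<theta> \<Longrightarrow> parcs G = max_arcs"
    using rho_le_supersolution[OF G conn ne sub R w_pos super] by blast+
qed

lemma rho_ge_split:
  assumes "vertex_split (pverts H) S I"
    and H: "pair_graph H" and ne: "pverts H \<noteq> {}"
    and arcs: "parcs H = vertex_split.max_arcs (pverts H) S I"
    and s: "card S = s" and n: "card (pverts H) = n"
    and pos: "a > 0" "b > 0" "c > 0"
    and S: "(real s - 1) * a + (real n - 2 * real s) * b + real s * c = \<theta> * a"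
    and C: "real s * a + (real n - 2 * real s - 1) * b = \<theta> * b"
    and I: "real s * a = \<theta> * c"
  shows "\<theta> \<le> rho H"
proof -
  interpret vertex_split "pverts H" S I by fact
  have "graph_eigenvalue H \<theta>"
    unfolding graph_eigenvalue_def
  proof (intro exI[of _ "weight a b c"] conjI ballI)
    show "\<exists>v\<in>pverts H. weight a b c v \<noteq> 0" using ne pos by (auto simp: weight_def)
  next
    fix v assume v: "v \<in> pverts H"
    show "(\<Sum>u\<in>pverts H. (if (v, u) \<in> parcs H then 1 else 0) * weight a b c u)
        = \<theta> * weight a b c v"
      unfolding arcs sum_weight[OF v s n] using S C I by (auto simp: weight_def)
  qed
  then show ?thesis by (rule rho_graph_eigenvalue(2)[OF H ne])
qed

text \<open>Whether two distinct vertices are joined in \<open>max_arcs\<close> depends only on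
  their parts, and corresponding parts have equal size; bijections between the parts therefore glue
  to an isomorphism.\<close>

lemma iso_of_splits:
  assumes "vertex_split (pverts G) S I" "vertex_split (pverts H) S' I'"
    and G: "pair_graph G" and H: "pair_graph H"
    and arcs: "parcs G = vertex_split.max_arcs (pverts G) S I"
      "parcs H = vertex_split.max_arcs (pverts H) S' I'"
    and card: "card S = card S'" "card (pverts G) = card (pverts H)"
  shows "digraph_iso (with_proj G) (with_proj H)"
proof -
  interpret G: vertex_split "pverts G" S I by fact
  interpret H: vertex_split "pverts H" S' I' by fact
  let ?C = "pverts G - S - I" and ?C' = "pverts H - S' - I'"
  have fin: "finite S" "finite I" "finite S'" "finite I'" "finite ?C" "finite ?C'"
    using G.finite_V H.finite_V G.S_subset G.I_subset H.S_subset H.I_subset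
    by (auto intro: finite_subset)
  have "card I = card I'" "card ?C = card ?C'"
    using card G.card_I H.card_I G.card_rest H.card_rest by simp_all
  then obtain p q r where p: "bij_betw p S S'" and q: "bij_betw q I I'" and r: "bij_betw r ?C ?C'"
    using card(1) fin by (metis finite_same_card_bij)
  define f where "f v = (if v \<in> S then p v else if v \<in> I then q v else r v)" for v
  have "bij_betw f S S'" using p by (rule bij_betw_cong[THEN iffD1, rotated]) (simp add: f_def)
  moreover have "bij_betw f I I'"
    using q by (rule bij_betw_cong[THEN iffD1, rotated]) (use G.disjoint in \<open>auto simp: f_def\<close>)
  moreover have "bij_betw f ?C ?C'"
    using r by (rule bij_betw_cong[THEN iffD1, rotated]) (auto simp: f_def)
  ultimately have bij: "bij_betw f (S \<union> I \<union> ?C) (S' \<union> I' \<union> ?C')"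
    using H.disjoint by (intro bij_betw_combine) auto
  have V: "S \<union> I \<union> ?C = pverts G" "S' \<union> I' \<union> ?C' = pverts H"
    using G.S_subset G.I_subset H.S_subset H.I_subset by auto
  have f: "bij_betw f (pverts G) (pverts H)" using bij unfolding V .
  have fS: "f v \<in> S' \<longleftrightarrow> v \<in> S" and fI: "f v \<in> I' \<longleftrightarrow> v \<in> I" if "v \<in> pverts G" for v
    using that p q r G.disjoint H.disjoint unfolding f_def bij_betw_def by auto
  have "(u, v) \<in> parcs G \<longleftrightarrow> (f u, f v) \<in> parcs H" if "u \<in> pverts G" "v \<in> pverts G" for u v
    using that f fS fI unfolding arcs G.max_arcs_def H.max_arcs_def
    by (auto simp: bij_betw_def inj_on_eq_iff)
  then show ?thesis unfolding digraph_iso_with_proj_iff[OF G H] using f by blast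
qed

text \<open>The same weights give \<open>\<theta> \<le> rho H\<close> by an eigenfunction and
  \<open>rho G \<le> \<theta>\<close> by a supersolution. Together with
  \<open>rho H \<le> rho G\<close> this is the equality case, which makes \<open>G\<close>
  edge-maximal.\<close>

lemma extremal_split_iso:
  assumes split: "vertex_split (pverts G) S I" "vertex_split (pverts H) S' I'"
    and G: "pair_graph G" and conn: "Digraph_Component.connected (with_proj G)"
    and H: "pair_graph H" and ne: "pverts G \<noteq> {}" "pverts H \<noteq> {}"
    and arcs: "parcs G \<subseteq> vertex_split.max_arcs (pverts G) S I"
      "parcs H = vertex_split.max_arcs (pverts H) S' I'"
    and card: "card S = s" "card S' = s" "card (pverts G) = n" "card (pverts H) = n"
    and pos: "a > 0" "b > 0" "c > 0"
    and eqs: "(real s - 1) * a + (real n - 2 * real s) * b + real s * c = \<theta> * a"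
      "real s * a + (real n - 2 * real s - 1) * b = \<theta> * b"
      "real s * a = \<theta> * c"
    and rho: "rho H \<le> rho G"
  shows "digraph_iso (with_proj G) (with_proj H)"
proof -
  note G_le = rho_le_split[OF split(1) G conn ne(1) arcs(1) card(1,3) pos eqs[THEN eq_refl]]
  have "\<theta> \<le> rho H"
    using rho_ge_split[OF split(2) H ne(2) arcs(2) card(2,4) pos eqs] .
  then have "parcs G = vertex_split.max_arcs (pverts G) S I" using G_le rho by simp
  then show ?thesis using iso_of_splits[OF split G H _ arcs(2)] card by simp
qed

lemma barrier_imp_vertex_split:
  assumes G: "pair_graph G" and k: "k > 0"
    and barrier: "{S. k_barrier k G S} \<noteq> {{}}"
  obtains S I where "S \<noteq> {}" "vertex_split (pverts G) S I"
    "parcs G \<subseteq> vertex_split.max_arcs (pverts G) S I"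
proof -
  interpret G: pair_graph G by fact
  have sym: "(u, v) \<in> parcs G \<longleftrightarrow> (v, u) \<in> parcs G" for u v
    using G.pair_sym_arcs by (auto simp: symmetric_def sym_def)
  let ?B = "barrier_value k G ` Pow (pverts G)"
  have fin: "finite ?B" by simp
  then have "k_deficiency k G \<in> ?B"
    unfolding k_deficiency_def by (rule Max_in) auto
  \<comment> \<open>Some barrier exists, so a set of barriers different from \<open>{{}}\<close>
    contains a nonempty one.\<close>
  then obtain S0 where "k_barrier k G S0" by (auto simp: k_barrier_def)
  then obtain S where S: "k_barrier k G S" "S \<noteq> {}" using barrier by blast
  then have sub: "S \<subseteq> pverts G" by (simp add: k_barrier_def)
  let ?J = "isolated_verts (delete_verts G S)"
  have "0 \<le> barrier_value k G {}" by (simp add: barrier_value_def)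
  also have "\<dots> \<le> barrier_value k G S"
    using S(1) fin by (simp add: k_barrier_def k_deficiency_def)
  finally have "int k * int (card S) \<le> int k * int (card ?J)"
    by (simp add: barrier_value_def)
  then have "card S \<le> card ?J" using k by simp
  \<comment> \<open>Only \<open>card S\<close> of the isolated vertices are kept; any others are
    counted with the rest, where \<open>max_arcs\<close> merely allows more arcs.\<close>
  then obtain I where I: "I \<subseteq> ?J" "card I = card S" by (meson obtain_subset_with_card_n)
  have J: "?J \<subseteq> pverts G - S"
    by (auto simp: isolated_verts_def delete_verts_def)
  have "v \<in> S" if u: "u \<in> ?J" and uv: "(u, v) \<in> parcs G" for u v
  proof (rule ccontr)
    assume "v \<notin> S"
    then have "(u, v) \<in> out_arcs (delete_verts G S) u"
      using u J uv G.wellformed'[OF uv] by (auto simp: delete_verts_def out_arcs_def)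
    moreover have "out_arcs (delete_verts G S) u = {}" using u by (simp add: isolated_verts_def)
    ultimately show False by blast
  qed
  then have nbrs: "v \<in> S" if "u \<in> I" "(u, v) \<in> parcs G" for u v using that I(1) by blast
  have split: "vertex_split (pverts G) S I"
    by unfold_locales (use sub I J in auto)
  moreover have "parcs G \<subseteq> vertex_split.max_arcs (pverts G) S I"
    unfolding vertex_split.max_arcs_def[OF split]
    using nbrs sym by (auto dest: G.wellformed' G.pair_no_loops)
  ultimately show thesis using that S(2) by blast
qed

section \<open>The extremal graphs\<close>

lemma disjoint_union_arcs [simp]:
  "(Inl u, Inl v) \<in> parcs (disjoint_union G H) \<longleftrightarrow> (u, v) \<in> parcs G"
  "(Inr x, Inr y) \<in> parcs (disjoint_union G H) \<longleftrightarrow> (x, y) \<in> parcs H"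
  "(Inl u, Inr y) \<notin> parcs (disjoint_union G H)"
  "(Inr x, Inl v) \<notin> parcs (disjoint_union G H)"
  by (auto simp: disjoint_union_def)

lemma graph_join_arcs [simp]:
  "(Inl u, Inl v) \<in> parcs (graph_join G H) \<longleftrightarrow> (u, v) \<in> parcs G"
  "(Inr x, Inr y) \<in> parcs (graph_join G H) \<longleftrightarrow> (x, y) \<in> parcs H"
  "(Inl u, Inr y) \<in> parcs (graph_join G H) \<longleftrightarrow> u \<in> pverts G \<and> y \<in> pverts H"
  "(Inr x, Inl v) \<in> parcs (graph_join G H) \<longleftrightarrow> x \<in> pverts H \<and> v \<in> pverts G"
  by (auto simp: graph_join_def)

text \<open>The split with \<open>2 * s\<close> vertices: the two factors of the join are
  \<open>S\<close> and \<open>I\<close>, and the third part is empty.\<close>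

lemma complete_join_edgeless_split:
  fixes s :: nat
  defines "H \<equiv> graph_join (complete_graph s) (edgeless_graph s)"
  shows "pair_graph H" "card (pverts H) = 2 * s"
    and "vertex_split (pverts H) (Inl ` {..<s}) (Inr ` {..<s})"
    and "parcs H = vertex_split.max_arcs (pverts H) (Inl ` {..<s}) (Inr ` {..<s})"
    and "card (Inl ` {..<s} :: (nat + nat) set) = s"
proof -
  show "pair_graph H" unfolding H_def
    by (intro pair_graph_graph_join pair_graph_complete_graph pair_graph_edgeless_graph)
  have V: "pverts H = {..<s} <+> {..<s}"
    by (simp add: H_def graph_join_def disjoint_union_def complete_graph_def edgeless_graph_def)
  then show "card (pverts H) = 2 * s" by (simp add: card_Plus)
  show split: "vertex_split (pverts H) (Inl ` {..<s}) (Inr ` {..<s})"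
    by unfold_locales (auto simp: V card_image)
  show "parcs H = vertex_split.max_arcs (pverts H) (Inl ` {..<s}) (Inr ` {..<s})"
  proof -
    have "(p, q) \<in> parcs H \<longleftrightarrow>
        (p, q) \<in> vertex_split.max_arcs (pverts H) (Inl ` {..<s}) (Inr ` {..<s})" for p q
      unfolding vertex_split.max_arcs_def[OF split] unfolding V
      by (cases p; cases q) (auto simp: H_def complete_graph_def edgeless_graph_def)
    then show ?thesis by (simp add: set_eq_iff)
  qed
  show "card (Inl ` {..<s} :: (nat + nat) set) = s" by (simp add: card_image)
qed

text \<open>The split with \<open>card S = 1\<close>: \<open>S\<close> holds the first factor of the
  join, \<open>I\<close> the pendant vertex, and the clique on \<open>m\<close> vertices is the
  rest.\<close>

lemma pendant_clique_split:
  fixes m :: nat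
  defines "H \<equiv> graph_join (complete_graph 1)
      (disjoint_union (complete_graph m) (complete_graph 1))"
    and "S \<equiv> {Inl 0}" and "I \<equiv> {Inr (Inr 0)}"
  shows "pair_graph H" "card (pverts H) = m + 2"
    and "vertex_split (pverts H) S I"
    and "parcs H = vertex_split.max_arcs (pverts H) S I"
proof -
  show "pair_graph H" unfolding H_def
    by (intro pair_graph_graph_join pair_graph_disjoint_union pair_graph_complete_graph)
  have V: "pverts H = {..<1} <+> ({..<m} <+> {..<1})"
    by (simp add: H_def graph_join_def disjoint_union_def complete_graph_def)
  then show "card (pverts H) = m + 2" by (simp add: card_Plus)
  show split: "vertex_split (pverts H) S I"
    by unfold_locales (auto simp: V S_def I_def)
  show "parcs H = vertex_split.max_arcs (pverts H) S I"
  proof -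
    have "(p, q) \<in> parcs H \<longleftrightarrow> (p, q) \<in> vertex_split.max_arcs (pverts H) S I" for p q
    proof -
      have cases: "(\<exists>x. e = Inl x) \<or> (\<exists>x. e = Inr (Inl x)) \<or> (\<exists>x. e = Inr (Inr x))"
        for e :: "nat + nat + nat"
        by (metis sum.exhaust)
      show ?thesis
        using cases[of p] cases[of q]
        unfolding vertex_split.max_arcs_def[OF split] unfolding V S_def I_def
        by (elim disjE exE) (auto simp: H_def complete_graph_def disjoint_union_def)
    qed
    then show ?thesis by (simp add: set_eq_iff)
  qed
qed

section \<open>Spectral radius and extremality of the clique with a pendant vertex\<close>

text \<open>The cubic is the characteristic polynomial of the quotient matrix of \<open>K\<^sub>1 \<or> (K\<^sub>N + K\<^sub>1)\<close>.\<close>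

lemma pendant_clique_root:
  fixes N :: real
  assumes "N \<ge> 1"
  obtains x where "x > N" "x\<^sup>2 * (x - N + 1) = N * x + (x - N + 1)"
proof -
  define p where "p x = x\<^sup>2 * (x - N + 1) - N * x - (x - N + 1)" for x
  have "p N = -1" by (simp add: p_def power2_eq_square)
  moreover have "p (N + 1) = N * N + 3 * N"
    by (simp add: p_def power2_eq_square algebra_simps)
  then have "p (N + 1) \<ge> 0" using assms by simp
  moreover have "continuous_on {N..N + 1} p"
    unfolding p_def by (intro continuous_intros)
  ultimately obtain x where x: "N \<le> x" "p x = 0"
    using IVT'[of p N 0 "N + 1"] by auto
  then have "x \<noteq> N" using \<open>p N = -1\<close> by auto
  then show thesis using that[of x] x by (simp add: p_def)
qed

text \<open>With weight 1 on \<open>S\<close>, the last two equations force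
  \<open>b = 1 / (x - N + 1)\<close> and \<open>c = 1 / x\<close> for \<open>N = n - 2\<close>, and
  the first becomes the cubic. The form \<open>real 1\<close> matches \<open>real s\<close> in the
  split lemmas at \<open>s = 1\<close>.\<close>

lemma pendant_clique_weights:
  assumes n: "n \<ge> 3"
  obtains b c \<theta> :: real where "b > 0" "c > 0" "\<theta> > real n - 2"
    "(real 1 - 1) * 1 + (real n - 2 * real 1) * b + real 1 * c = \<theta> * 1"
    "real 1 * 1 + (real n - 2 * real 1 - 1) * b = \<theta> * b"
    "real 1 * 1 = \<theta> * c"
proof -
  define N where "N = real n - 2"
  have N: "N \<ge> 1" using n by (simp add: N_def)
  obtain x where x: "x > N" and eq: "x\<^sup>2 * (x - N + 1) = N * x + (x - N + 1)"
    using pendant_clique_root[OF N] .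
  have pos: "x > 0" "x - N + 1 > 0" using x N by simp_all
  show thesis
  proof (rule that[of "1 / (x - N + 1)" "1 / x" x])
    show "(real 1 - 1) * 1 + (real n - 2 * real 1) * (1 / (x - N + 1)) + real 1 * (1 / x) = x * 1"
    proof -
      define D where "D = x - N + 1"
      have "N / D + 1 / x = x"
        using pos eq unfolding D_def[symmetric] by (simp add: field_simps power2_eq_square)
      then show ?thesis by (simp add: N_def D_def)
    qed
    have n_eq: "real n - 2 * real 1 - 1 = N - 1" by (simp add: N_def)
    show "real 1 * 1 + (real n - 2 * real 1 - 1) * (1 / (x - N + 1)) = x * (1 / (x - N + 1))"
      unfolding n_eq using pos by (simp add: field_simps)
  qed (use pos x in \<open>simp_all add: N_def\<close>)
qed

text \<open>The strict inequality is what excludes splits with \<open>card S \<ge> 2\<close>, for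
  which the bound is \<open>n - 2\<close> itself.\<close>

lemma rho_pendant_clique_gt:
  assumes n: "n \<ge> 3"
  shows "rho (graph_join (complete_graph 1)
    (disjoint_union (complete_graph (n - 2)) (complete_graph 1))) > real n - 2"
proof -
  obtain b c \<theta> where w: "b > 0" "c > 0" "\<theta> > real n - 2"
    and eqs: "(real 1 - 1) * 1 + (real n - 2 * real 1) * b + real 1 * c = \<theta> * 1"
    "real 1 * 1 + (real n - 2 * real 1 - 1) * b = \<theta> * b"
    "real 1 * 1 = \<theta> * c"
    using pendant_clique_weights[OF n] .
  note H = pendant_clique_split[of "n - 2"]
  have one_pos: "0 < (1::real)" by simp
  have "\<theta> \<le> rho (graph_join (complete_graph 1)
    (disjoint_union (complete_graph (n - 2)) (complete_graph 1)))"
  proof (rule rho_ge_split[OF H(3,1) _ H(4) _ _ one_pos w(1,2) eqs])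
    show "pverts (graph_join (complete_graph 1)
        (disjoint_union (complete_graph (n - 2)) (complete_graph 1))) \<noteq> {}"
      by (rule notI) (use H(2) in simp)
  qed (use H(2) n in auto)
  then show ?thesis using w(3) by simp
qed

text \<open>\<open>(a, b, c) = (1, s/(2s-1), s/(n-2))\<close> is tight on the clique and on the independent set.\<close>

lemma rho_le_large_split:
  assumes split: "vertex_split (pverts G) S I"
    and G: "pair_graph G" and conn: "Digraph_Component.connected (with_proj G)"
    and sub: "parcs G \<subseteq> vertex_split.max_arcs (pverts G) S I"
    and s: "card S = s" "s \<ge> 2" and n: "card (pverts G) = n" "n = 5 \<or> n \<ge> 7"
  shows "rho G \<le> real n - 2"
proof -
  have ns: "2 * s \<le> n" using vertex_split.card_rest[OF split] s n by simp
  define u where "u = real s"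
  define x where "x = real n"
  have ux: "u \<ge> 2" "x \<ge> 2 * u" "x \<ge> 5" using s n ns by (auto simp: u_def x_def)
  \<comment> \<open>This is the inequality on \<open>S\<close> for the chosen weights, with
    denominators cleared.\<close>
  have key: "u\<^sup>2 * (2 * u - 1) \<le> (u - 1) * (x - 1) * (x - 2)"
  proof -
    consider "s = 2" | "s = 3" | "s \<ge> 4" using s by linarith
    then show ?thesis
    proof cases
      case 1
      have "4 * 3 \<le> (x - 1) * (x - 2)" using ux by (intro mult_mono) auto
      then show ?thesis using 1 by (simp add: u_def)
    next
      case 2
      \<comment> \<open>Here \<open>n \<ge> 2 * s = 6\<close>, and order 6 is excluded; for it the
        claim would read 45 <= 40.\<close>
      then have "x \<ge> 7" using n ns by (auto simp: x_def)
      then have "6 * 5 \<le> (x - 1) * (x - 2)" by (intro mult_mono) auto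
      then show ?thesis using 2 by (simp add: u_def algebra_simps)
    next
      case 3
      then have u: "u \<ge> 4" by (simp add: u_def)
      \<comment> \<open>Since \<open>x \<ge> 2 * u\<close>, it suffices to treat
        \<open>x = 2 * u\<close>, where the claim reduces to
        \<open>u\<^sup>2 \<le> 2 * (u - 1)\<^sup>2\<close>.\<close>
      have "2 * (u - 1)\<^sup>2 - u\<^sup>2 = u * (u - 4) + 2" by (simp add: power2_eq_square algebra_simps)
      then have "u\<^sup>2 \<le> 2 * (u - 1)\<^sup>2" using u mult_nonneg_nonneg[of u "u - 4"] by linarith
      then have "u\<^sup>2 * (2 * u - 1) \<le> 2 * (u - 1)\<^sup>2 * (2 * u - 1)"
        using u by (intro mult_right_mono) auto
      also have "\<dots> = (u - 1) * ((2 * u - 1) * (2 * u - 2))"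
        by (simp add: power2_eq_square algebra_simps)
      also have "\<dots> \<le> (u - 1) * ((x - 1) * (x - 2))"
        using ux u by (intro mult_left_mono mult_mono) auto
      finally show ?thesis by (simp add: mult.assoc)
    qed
  qed
  have "u\<^sup>2 / (x - 2) \<le> (u - 1) * (x - 1) / (2 * u - 1)"
    using key ux by (simp add: divide_le_eq pos_le_divide_eq field_simps)
  also have "\<dots> = (x - 2) - (u - 1) - (x - 2 * u) * (u / (2 * u - 1))"
    using ux by (simp add: field_simps)
  finally have S: "(u - 1) * 1 + (x - 2 * u) * (u / (2 * u - 1)) + u * (u / (x - 2)) \<le> (x - 2) * 1"
    by (simp add: power2_eq_square)
  have C: "u * 1 + (x - 2 * u - 1) * (u / (2 * u - 1)) \<le> (x - 2) * (u / (2 * u - 1))"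
    using ux by (simp add: field_simps)
  have I: "u * 1 \<le> (x - 2) * (u / (x - 2))" using ux by simp
  have pos: "u / (2 * u - 1) > 0" "u / (x - 2) > 0" using ux by simp_all
  have one_pos: "0 < (1::real)" by simp
  have "pverts G \<noteq> {}" using n by auto
  from rho_le_split(1)[OF split G conn this sub s(1) n(1) one_pos pos[unfolded u_def x_def]
      S[unfolded u_def x_def] C[unfolded u_def x_def] I[unfolded u_def x_def]]
  show ?thesis .
qed

lemma pendant_clique_extremal:
  fixes G :: "'a pair_pre_digraph" and n :: nat
  defines "H \<equiv> graph_join (complete_graph 1)
      (disjoint_union (complete_graph (n - 2)) (complete_graph 1))"
  assumes split: "vertex_split (pverts G) S I" and S: "S \<noteq> {}"
    and G: "pair_graph G" and conn: "Digraph_Component.connected (with_proj G)"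
    and sub: "parcs G \<subseteq> vertex_split.max_arcs (pverts G) S I"
    and n: "card (pverts G) = n" "n = 3 \<or> n = 5 \<or> n \<ge> 7"
    and rho: "rho H \<le> rho G"
  shows "digraph_iso (with_proj G) (with_proj H)"
proof -
  have ns: "2 * card S \<le> n" using vertex_split.card_rest[OF split] n by simp
  have "finite S"
    using vertex_split.finite_V[OF split] vertex_split.S_subset[OF split] by (rule rev_finite_subset)
  then have "card S \<noteq> 0" using S by simp
  then consider "card S = 1" | "card S \<ge> 2" by linarith
  then show ?thesis
  proof cases
    case 1
    have n3: "n \<ge> 3" using n by auto
    obtain b c \<theta> where w: "b > 0" "c > 0"
      and eqs: "(real 1 - 1) * 1 + (real n - 2 * real 1) * b + real 1 * c = \<theta> * 1"
      "real 1 * 1 + (real n - 2 * real 1 - 1) * b = \<theta> * b"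
      "real 1 * 1 = \<theta> * c"
      using pendant_clique_weights[OF n3] .
    note H = pendant_clique_split[of "n - 2", folded H_def]
    have one_pos: "0 < (1::real)" by simp
    have HV: "card (pverts H) = n" using H(2) n3 by simp
    have ne: "pverts G \<noteq> {}" "pverts H \<noteq> {}" using n HV n3 by auto
    show ?thesis
      by (rule extremal_split_iso[OF split H(3) G conn H(1) ne sub H(4) 1 _ n(1) HV
            one_pos w eqs rho]) simp
  next
    case 2
    \<comment> \<open>This contradicts the strict lower bound for \<open>rho H\<close>, so no such
      split occurs.\<close>
    then have "rho G \<le> real n - 2"
      using rho_le_large_split[OF split G conn sub refl _ n(1)] n(2) ns by linarith
    then show ?thesis using rho_pendant_clique_gt[of n] n(2) rho by (auto simp: H_def)
  qed
qed

section \<open>Orders 4 and 6, where the balanced split is extremal\<close>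

lemma complete_join_edgeless_extremal:
  fixes G :: "'a pair_pre_digraph" and n :: nat
  defines "H \<equiv> graph_join (complete_graph (n div 2)) (edgeless_graph (n div 2))"
  assumes split: "vertex_split (pverts G) S I" and S: "S \<noteq> {}"
    and G: "pair_graph G" and conn: "Digraph_Component.connected (with_proj G)"
    and sub: "parcs G \<subseteq> vertex_split.max_arcs (pverts G) S I"
    and n: "card (pverts G) = n" "n = 4 \<or> n = 6"
    and rho: "rho H \<le> rho G"
  shows "digraph_iso (with_proj G) (with_proj H)"
proof -
  define s where "s = n div 2"
  define u where "u = real s"
  have s: "n = 2 * s" "s = 2 \<or> s = 3" using n by (auto simp: s_def)
  have u: "u = 2 \<or> u = 3" using s by (auto simp: u_def)
  \<comment> \<open>The positive root of the characteristic polynomial of the quotient matrix on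
    \<open>S\<close> and \<open>I\<close>; the eigenfunction takes the values
    \<open>\<theta>\<close> on \<open>S\<close> and \<open>u\<close> on \<open>I\<close>.\<close>
  define \<theta> where "\<theta> = (u - 1 + sqrt ((u - 1)\<^sup>2 + 4 * u\<^sup>2)) / 2"
  have quad: "\<theta> * \<theta> = (u - 1) * \<theta> + u * u"
  proof -
    define r where "r = sqrt ((u - 1)\<^sup>2 + 4 * u\<^sup>2)"
    have "r * r = (u - 1)\<^sup>2 + 4 * u\<^sup>2" by (simp add: r_def)
    then show ?thesis unfolding \<theta>_def r_def[symmetric]
      by (simp add: field_simps power2_eq_square)
  qed
  \<comment> \<open>The rational numbers 5/2 and 41/10 separate \<open>\<theta>\<close> from the
    spectral radii of the splits with smaller \<open>S\<close>. For order 6 the value 4 would be too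
    small, since the split with \<open>card S = 1\<close> allows a radius above 4.\<close>
  have \<theta>4: "\<theta> > 5 / 2" if "n = 4"
  proof -
    have "4 < sqrt (17::real)" by (rule real_less_rsqrt) simp
    then show ?thesis using that s by (simp add: \<theta>_def u_def)
  qed
  have \<theta>6: "\<theta> > 41 / 10" if "n = 6"
  proof -
    have "31 / 5 < sqrt (40::real)" by (rule real_less_rsqrt) (simp add: power2_eq_square)
    then show ?thesis using that s by (simp add: \<theta>_def u_def)
  qed
  have pos: "\<theta> > 0" "u > 0" using \<theta>4 \<theta>6 n u by auto
  \<comment> \<open>No vertex carries the weight \<open>b\<close> here; its value only has to satisfy the second equation.\<close>
  have b_pos: "u * \<theta> / (\<theta> + 1) > 0" using pos by simp
  have n_u: "real n = 2 * real s" using s by simp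
  have eqs: "(real s - 1) * \<theta> + (real n - 2 * real s) * (u * \<theta> / (\<theta> + 1)) + real s * u = \<theta> * \<theta>"
    "real s * \<theta> + (real n - 2 * real s - 1) * (u * \<theta> / (\<theta> + 1)) = \<theta> * (u * \<theta> / (\<theta> + 1))"
    "real s * \<theta> = \<theta> * u"
    using quad pos unfolding n_u u_def[symmetric] by (simp_all add: field_simps)
  note H = complete_join_edgeless_split[of s, folded H_def[folded s_def]]
  have HV: "card (pverts H) = n" using H(2) s by simp
  have ne: "pverts G \<noteq> {}" "pverts H \<noteq> {}" using n HV by auto
  have \<theta>_le: "\<theta> \<le> rho H"
    by (rule rho_ge_split[OF H(3,1) ne(2) H(4,5) HV pos(1) b_pos pos(2) eqs])
  have ns: "2 * card S \<le> n" using vertex_split.card_rest[OF split] n by simp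
  have "finite S"
    using vertex_split.finite_V[OF split] vertex_split.S_subset[OF split] by (rule rev_finite_subset)
  then have "card S \<noteq> 0" using S by simp
  then consider "card S = s" | "n = 4" "card S = 1" | "n = 6" "card S = 1" | "n = 6" "card S = 2"
    using s ns n by linarith
  then show ?thesis
  proof cases
    case 1
    show ?thesis
      by (rule extremal_split_iso[OF split H(3) G conn H(1) ne sub H(4) 1 H(5) n(1) HV
            pos(1) b_pos pos(2) eqs rho])
  next
    case 2
    \<comment> \<open>With \<open>a = 1\<close>, the weights \<open>b\<close> and \<open>c\<close>
      make the conditions on the rest and on \<open>I\<close> equalities at the rational bound,
      leaving only the condition on \<open>S\<close> as a strict inequality. The two cases below use
      the same recipe.\<close>
    have "rho G \<le> 5 / 2"
      by (rule rho_le_split(1)[OF split G conn ne(1) sub 2(2) n(1),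
            of 1 "2 / 3" "2 / 5"]) (simp_all add: 2)
    then show ?thesis using \<theta>4[OF 2(1)] \<theta>_le rho by simp
  next
    case 3
    have "rho G \<le> 41 / 10"
      by (rule rho_le_split(1)[OF split G conn ne(1) sub 3(2) n(1),
            of 1 "10 / 11" "10 / 41"]) (simp_all add: 3)
    then show ?thesis using \<theta>6[OF 3(1)] \<theta>_le rho by simp
  next
    case 4
    have "rho G \<le> 41 / 10"
      by (rule rho_le_split(1)[OF split G conn ne(1) sub 4(2) n(1),
            of 1 "20 / 31" "20 / 41"]) (simp_all add: 4)
    then show ?thesis using \<theta>6[OF 4(1)] \<theta>_le rho by simp
  qed
qed

theorem theorem6p2:
  fixes G :: "'a pair_pre_digraph" and n k :: nat
  assumes "n \<ge> 3"
    and "k \<ge> 2" and "even k"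
    and "pair_graph G"
    and "Digraph_Component.connected (with_proj G)"
    and "card (pverts G) = n"
  shows
    "((n \<ge> 7 \<or> n = 3 \<or> n = 5) \<and>
      rho G \<ge> rho (graph_join (complete_graph 1)
                        (disjoint_union (complete_graph (n - 2)) (complete_graph 1))) \<longrightarrow>
      \<not> digraph_iso (with_proj G)
          (with_proj (graph_join (complete_graph 1)
                           (disjoint_union (complete_graph (n - 2)) (complete_graph 1)))) \<longrightarrow>
      (odd n \<longrightarrow> GFC k G) \<and> (even n \<longrightarrow> GBC k G))
     \<and>
     (n \<in> {4, 6} \<and>
      rho G \<ge> rho (graph_join (complete_graph (n div 2)) (edgeless_graph (n div 2))) \<longrightarrow>
      \<not> digraph_iso (with_proj G)
          (with_proj (graph_join (complete_graph (n div 2)) (edgeless_graph (n div 2)))) \<longrightarrow>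
      GBC k G)"
proof -
  have k: "k > 0" using assms(2) by simp
  let ?P = "graph_join (complete_graph 1)
    (disjoint_union (complete_graph (n - 2)) (complete_graph 1))"
  let ?K = "graph_join (complete_graph (n div 2)) (edgeless_graph (n div 2))"
  \<comment> \<open>\<open>GFC\<close> and \<open>GBC\<close> share this condition on barriers and
    differ only in the parity of the order, which is supplied at the end.\<close>
  have P: "{S. k_barrier k G S} = {{}}"
    if "n \<ge> 7 \<or> n = 3 \<or> n = 5" "rho G \<ge> rho ?P" "\<not> digraph_iso (with_proj G) (with_proj ?P)"
  proof (rule ccontr)
    assume "\<not> ?thesis"
    then obtain S I where "S \<noteq> {}" "vertex_split (pverts G) S I"
      "parcs G \<subseteq> vertex_split.max_arcs (pverts G) S I"
      using barrier_imp_vertex_split[OF assms(4) k] by blast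
    then show False using pendant_clique_extremal assms(4-6) that by blast
  qed
  have K: "{S. k_barrier k G S} = {{}}"
    if "n \<in> {4, 6}" "rho G \<ge> rho ?K" "\<not> digraph_iso (with_proj G) (with_proj ?K)"
  proof (rule ccontr)
    assume "\<not> ?thesis"
    then obtain S I where "S \<noteq> {}" "vertex_split (pverts G) S I"
      "parcs G \<subseteq> vertex_split.max_arcs (pverts G) S I"
      using barrier_imp_vertex_split[OF assms(4) k] by blast
    then show False using complete_join_edgeless_extremal assms(4-6) that by blast
  qed
  have "even n" if "n \<in> {4, 6}" using that by auto
  then show ?thesis unfolding GFC_def GBC_def assms(6) using P K by blast
qed

end
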